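(* Let $A,B,X\in\mathcal{M}_n$ be such that $\begin{bmatrix} A & X^*\\ X & B\end{bmatrix}$ is positive semidefinite, and let $X=U|X|$ be a polar decomposition of $X$ with $U\in\mathcal{M}_n$ unitary. Then $$\left\|\begin{bmatrix} A & X^*\\ X & B\end{bmatrix}\right\|\le\left\|A+U^*BU\right\|.$$
   Context: $\mathcal{M}_n$ is the algebra of $n\times n$ complex matrices; $\|\cdot\|$ is the usual operator (spectral) norm; $|X|=(X^*X)^{1/2}$. Polar decomposition $X=U|X|$ is taken with $U$ unitary. *)

theory Defs
  imports "HOL-Analysis.Analysis"
begin

definition adjoint_mat :: "complex ^ 'n ^ 'm \<Rightarrow> complex ^ 'm ^ 'n"  ("(_\<^sup>\<dagger>)" [1000] 999)
  where "X\<^sup>\<dagger> = (\<chi> i j. cnj (X $ j $ i))"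

definition hermitian_mat :: "complex ^ 'n ^ 'n \<Rightarrow> bool"
  where "hermitian_mat M \<longleftrightarrow> M\<^sup>\<dagger> = M"

definition unitary_mat :: "complex ^ 'n ^ 'n \<Rightarrow> bool"
  where "unitary_mat U \<longleftrightarrow> U\<^sup>\<dagger> ** U = mat 1 \<and> U ** U\<^sup>\<dagger> = mat 1"

definition psd_mat :: "complex ^ 'n ^ 'n \<Rightarrow> bool"
  where "psd_mat M \<longleftrightarrow>
    hermitian_mat M \<and> (\<forall>x. (\<Sum>i\<in>UNIV. cnj (x $ i) * (M *v x) $ i) \<in> \<real>\<^sub>\<ge>\<^sub>0)"

(* Meaningful for positive semidefinite M, which has exactly one positive semidefinite square root. *)
definition psd_sqrt :: "complex ^ 'n ^ 'n \<Rightarrow> complex ^ 'n ^ 'n"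
  where "psd_sqrt M = (THE P. psd_mat P \<and> P ** P = M)"

definition abs_mat :: "complex ^ 'n ^ 'n \<Rightarrow> complex ^ 'n ^ 'n"
  where "abs_mat X = psd_sqrt (X\<^sup>\<dagger> ** X)"

(* The norm of the library on complex ^ 'n is the Euclidean (Hermitian) one, so this is the
   spectral norm. *)
definition op_norm :: "complex ^ 'n ^ 'm \<Rightarrow> real"
  where "op_norm M = onorm (\<lambda>x. M *v x)"

(* The rows of the block matrix [A, B; C, D] are indexed by 'm + 'p, its columns by 'n + 'q. *)
definition block_mat ::
    "complex ^ 'n ^ 'm \<Rightarrow> complex ^ 'q ^ 'm \<Rightarrow> complex ^ 'n ^ 'p \<Rightarrow> complex ^ 'q ^ 'p
      \<Rightarrow> complex ^ ('n + 'q) ^ ('m + 'p)"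
  where "block_mat A B C D = (\<chi> i j.
    case i of
      Inl k \<Rightarrow> (case j of Inl l \<Rightarrow> A $ k $ l | Inr l \<Rightarrow> B $ k $ l)
    | Inr k \<Rightarrow> (case j of Inl l \<Rightarrow> C $ k $ l | Inr l \<Rightarrow> D $ k $ l))"

end

theory Submission
  imports Defs
begin

text \<open>
  Write \<open>P = |X|\<close> and let \<open>M\<close> be the block matrix. With \<open>C = U\<^sup>\<dagger> B U\<close>, the matrix \<open>M\<close> is unitarily
  equivalent to \<open>[A, P; P, C]\<close>, because \<open>P\<close> is Hermitian. Conjugating the latter by \<open>[0, 1; -1, 0]\<close>
  yields the positive semidefinite matrix \<open>[C, -P; -P, A]\<close>, and the two add up to
  \<open>[A + C, 0; 0, A + C]\<close>. Hence the quadratic form of \<open>M\<close> is at most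
  \<open>\<parallel>A + C\<parallel>\<close> times the squared norm, which bounds \<open>\<parallel>M\<parallel>\<close> by Cauchy-Schwarz.

  That \<open>P\<close> is Hermitian rests on the existence and uniqueness of positive semidefinite square
  roots. A maximiser of the Rayleigh quotient is an eigenvector, and splitting it off reduces the
  rank, which gives existence. If \<open>P\<^sup>2 = Q\<^sup>2\<close> and \<open>D = P - Q\<close>, then \<open>P D = - D Q\<close>, so \<open>P D\<^sup>2 = - D Q D\<close>;
  an eigenvector of \<open>D\<^sup>2\<close> with positive eigenvalue would be annihilated by \<open>P\<close> and \<open>Q\<close>, thus by \<open>D\<close>.
\<close>

section \<open>The Hermitian inner product\<close>

text \<open>The library product \<open>\<bullet>\<close> on complex vectors is only the real part of
  this form; the projection coefficients below need the full complex value.\<close>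

definition cdot :: "complex ^ 'n \<Rightarrow> complex ^ 'n \<Rightarrow> complex"
  where "cdot x y = (\<Sum>i\<in>UNIV. cnj (x $ i) * y $ i)"

lemma Re_cdot: "Re (cdot x y) = x \<bullet> y"
  by (simp add: cdot_def inner_vec_def inner_complex_def)

lemma cnj_cdot: "cnj (cdot x y) = cdot y x"
  by (simp add: cdot_def mult.commute)

lemma cdot_self: "cdot x x = of_real (x \<bullet> x)"
proof -
  have "Im (cdot x x) = 0"
    using arg_cong[OF cnj_cdot[of x x], of Im] by simp
  then show ?thesis
    by (simp add: complex_eq_iff Re_cdot)
qed

lemma cdot_add_right: "cdot x (y + z) = cdot x y + cdot x z"
  by (simp add: cdot_def sum.distrib algebra_simps)

lemma cdot_scale_right: "cdot x (c *s y) = c * cdot x y"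
  by (simp add: cdot_def sum_distrib_left algebra_simps)

lemma cdot_zero_left [simp]: "cdot 0 x = 0"
  by (simp add: cdot_def)

lemma inner_scale_right: "x \<bullet> (c *s y) = Re (c * cdot x y)"
  by (metis Re_cdot cdot_scale_right)

lemma cdot_adjoint:
  fixes M :: "complex ^ 'n ^ 'm"
  shows "cdot x (M *v y) = cdot (M\<^sup>\<dagger> *v x) y"
proof -
  have "cdot x (M *v y) = (\<Sum>i\<in>UNIV. \<Sum>j\<in>UNIV. cnj (x $ i) * M $ i $ j * y $ j)"
    by (simp add: cdot_def matrix_vector_mult_def sum_distrib_left mult.assoc)
  also have "\<dots> = (\<Sum>j\<in>UNIV. \<Sum>i\<in>UNIV. cnj (x $ i) * M $ i $ j * y $ j)"
    by (rule sum.swap)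
  also have "\<dots> = cdot (M\<^sup>\<dagger> *v x) y"
    by (simp add: cdot_def matrix_vector_mult_def adjoint_mat_def sum_distrib_right
        sum_distrib_left mult_ac)
  finally show ?thesis .
qed

lemma inner_adjoint:
  fixes M :: "complex ^ 'n ^ 'm"
  shows "x \<bullet> (M *v y) = (M\<^sup>\<dagger> *v x) \<bullet> y"
  by (metis Re_cdot cdot_adjoint)

lemma adjoint_adjoint [simp]: "(M\<^sup>\<dagger>)\<^sup>\<dagger> = M"
  by (simp add: adjoint_mat_def vec_eq_iff)

lemma adjoint_mult: "(M ** N)\<^sup>\<dagger> = N\<^sup>\<dagger> ** M\<^sup>\<dagger>"
  by (simp add: adjoint_mat_def matrix_matrix_mult_def vec_eq_iff mult.commute)

lemma hermitian_inner:
  "hermitian_mat M \<Longrightarrow> x \<bullet> (M *v y) = (M *v x) \<bullet> y"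
  using inner_adjoint[of x M y] by (simp add: hermitian_mat_def)

lemma hermitian_mult_self: "hermitian_mat D \<Longrightarrow> hermitian_mat (D ** D)"
  by (simp add: hermitian_mat_def adjoint_mult)

lemma hermitian_add: "hermitian_mat M \<Longrightarrow> hermitian_mat N \<Longrightarrow> hermitian_mat (M + N)"
  by (simp add: hermitian_mat_def adjoint_mat_def vec_eq_iff)

lemma hermitian_diff: "hermitian_mat M \<Longrightarrow> hermitian_mat N \<Longrightarrow> hermitian_mat (M - N)"
  by (simp add: hermitian_mat_def adjoint_mat_def vec_eq_iff)

section \<open>Positive semidefinite matrices\<close>

text \<open>For Hermitian \<open>M\<close> the number \<open>cdot x (M *v x)\<close> equals its own
  conjugate, so it is real and \<open>\<bullet>\<close> captures it. All later positivity arguments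
  can therefore use real quadratic forms.\<close>

lemma psd_mat_iff:
  "psd_mat M \<longleftrightarrow> hermitian_mat M \<and> (\<forall>x. 0 \<le> x \<bullet> (M *v x))"
proof -
  have "cdot x (M *v x) \<in> \<real>\<^sub>\<ge>\<^sub>0 \<longleftrightarrow> 0 \<le> x \<bullet> (M *v x)" if "hermitian_mat M" for x
  proof -
    have "cdot x (M *v x) = cnj (cdot x (M *v x))"
      using that by (metis cdot_adjoint cnj_cdot hermitian_mat_def)
    then have "Im (cdot x (M *v x)) = 0"
      by (metis cnj.simps(2) equal_neg_zero)
    then show ?thesis
      by (simp add: complex_nonneg_Reals_iff Re_cdot)
  qed
  then show ?thesis
    unfolding psd_mat_def cdot_def[symmetric] by blast
qed

lemma psd_hermitian: "psd_mat M \<Longrightarrow> hermitian_mat M"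
  by (simp add: psd_mat_def)

lemma psd_nonneg: "psd_mat M \<Longrightarrow> 0 \<le> x \<bullet> (M *v x)"
  by (simp add: psd_mat_iff)

lemma psd_Cauchy_Schwarz:
  assumes "psd_mat M"
  shows "(x \<bullet> (M *v y))\<^sup>2 \<le> (x \<bullet> (M *v x)) * (y \<bullet> (M *v y))"
proof -
  let ?a = "x \<bullet> (M *v x)" and ?b = "x \<bullet> (M *v y)" and ?c = "y \<bullet> (M *v y)"
  have sym: "y \<bullet> (M *v x) = ?b"
    using hermitian_inner[OF psd_hermitian[OF assms]] by (metis inner_commute)
  have form: "0 \<le> s\<^sup>2 * ?a + 2 * s * t * ?b + t\<^sup>2 * ?c" for s t :: real
  proof -
    have "0 \<le> (s *\<^sub>R x + t *\<^sub>R y) \<bullet> (M *v (s *\<^sub>R x + t *\<^sub>R y))"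
      by (rule psd_nonneg[OF assms])
    also have "M *v (s *\<^sub>R x + t *\<^sub>R y) = s *\<^sub>R (M *v x) + t *\<^sub>R (M *v y)"
      by (simp add: linear_add linear_scale)
    finally show ?thesis
      by (simp add: inner_add_left inner_add_right sym algebra_simps power2_eq_square)
  qed
  show ?thesis
  proof (cases "?a = 0")
    case True
    have "?b = 0"
    proof (rule ccontr)
      assume "?b \<noteq> 0"
      \<comment> \<open>This choice of \<open>s\<close> makes the form equal to -1.\<close>
      with form[of "- (?c + 1) / (2 * ?b)" 1] True show False
        by (simp add: field_simps)
    qed
    then show ?thesis by (simp add: True)
  next
    case False
    then have "0 < ?a"
      using psd_nonneg[OF assms, of x] by simp
    moreover have "0 \<le> ?a * (?a * ?c - ?b\<^sup>2)"
      \<comment> \<open>At s = -b, t = a the form factors as a(ac - b^2).\<close>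
      using form[of "- ?b" ?a] by (simp add: algebra_simps power2_eq_square)
    ultimately show ?thesis
      by (simp add: zero_le_mult_iff)
  qed
qed

lemma psd_form_eq_0_imp:
  assumes "psd_mat M" "x \<bullet> (M *v x) = 0"
  shows "M *v x = 0"
proof -
  have "((M *v x) \<bullet> (M *v x))\<^sup>2 \<le> 0"
    using psd_Cauchy_Schwarz[OF assms(1), of "M *v x" x] assms(2) by simp
  then show ?thesis by simp
qed

lemma psd_eigenvector:
  assumes psd: "psd_mat M" and "M \<noteq> 0"
  obtains v r where "norm v = 1" "0 < r" "M *v v = of_real r *s v"
proof -
  let ?S = "sphere (0 :: complex ^ 'n) 1"
  have "\<exists>v\<in>?S. \<forall>x\<in>?S. x \<bullet> (M *v x) \<le> v \<bullet> (M *v v)"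
  proof (rule continuous_attains_sup)
    show "continuous_on ?S (\<lambda>x. x \<bullet> (M *v x))"
      by (intro continuous_intros linear_continuous_on linear_linear[THEN iffD2]) simp
    show "?S \<noteq> {}" by simp
  qed simp
  then obtain v where v: "norm v = 1"
    and max: "\<And>x. norm x = 1 \<Longrightarrow> x \<bullet> (M *v x) \<le> v \<bullet> (M *v v)"
    by auto
  define r where "r = v \<bullet> (M *v v)"
  have le: "x \<bullet> (M *v x) \<le> r * (x \<bullet> x)" for x
  proof (cases "x = 0")
    case False
    then have "((1 / norm x) *\<^sub>R x) \<bullet> (M *v ((1 / norm x) *\<^sub>R x)) \<le> r"
      unfolding r_def by (intro max) simp
    then have "x \<bullet> (M *v x) / (norm x)\<^sup>2 \<le> r"
      by (simp add: linear_scale power2_eq_square)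
    then show ?thesis
      using False by (simp add: divide_le_eq power2_norm_eq_inner)
  qed simp
  \<comment> \<open>Since \<open>r\<close> is the maximum of the Rayleigh quotient, r I - M is
    positive semidefinite; its form vanishes at the maximiser \<open>v\<close>, so \<open>v\<close>
    lies in its kernel, which is the eigenvalue equation.\<close>
  let ?N = "mat (of_real r) - M"
  have N: "?N *v x = of_real r *s x - M *v x" for x
  proof -
    have "mat c *v x = c *s x" for c :: complex
      by (simp add: vec_eq_iff matrix_vector_mult_def mat_def
          if_distrib[of "\<lambda>a. a * b" for b] cong: if_cong)
    then show ?thesis
      by (simp add: matrix_vector_mult_diff_rdistrib)
  qed
  have inner_N: "x \<bullet> (?N *v x) = r * (x \<bullet> x) - x \<bullet> (M *v x)" for x
    by (simp add: N inner_diff_right inner_scale_right Re_cdot)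
  have "hermitian_mat ?N"
    by (intro hermitian_diff psd_hermitian[OF psd])
      (simp add: hermitian_mat_def adjoint_mat_def mat_def vec_eq_iff)
  then have "psd_mat ?N"
    using le by (simp add: psd_mat_iff inner_N)
  moreover have "v \<bullet> (?N *v v) = 0"
    using v unfolding inner_N by (simp add: r_def norm_eq_1)
  ultimately have "?N *v v = 0"
    by (rule psd_form_eq_0_imp)
  then have eig: "M *v v = of_real r *s v"
    by (simp add: N)
  have "r \<noteq> 0"
  proof
    assume "r = 0"
    then have "M *v x = 0" for x
      using le[of x] psd_nonneg[OF psd, of x] by (intro psd_form_eq_0_imp[OF psd]) simp
    then show False
      using \<open>M \<noteq> 0\<close> by (simp add: matrix_eq)
  qed
  then have "0 < r"
    using psd_nonneg[OF psd, of v] by (simp add: r_def)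
  then show ?thesis
    using that v eig by blast
qed

section \<open>The positive semidefinite square root\<close>

text \<open>The matrix c v v*: for a unit vector \<open>v\<close>, this is \<open>c\<close> times
  the orthogonal projection onto the complex line of \<open>v\<close>.\<close>

definition rank_one :: "real \<Rightarrow> complex ^ 'n \<Rightarrow> complex ^ 'n ^ 'n"
  where "rank_one c v = (\<chi> i j. of_real c * v $ i * cnj (v $ j))"

lemma rank_one_mult: "rank_one c v *v x = (of_real c * cdot v x) *s v"
  by (simp add: vec_eq_iff matrix_vector_mult_def rank_one_def cdot_def sum_distrib_left
      sum_distrib_right mult_ac)

lemma rank_one_hermitian: "hermitian_mat (rank_one c v)"
  by (simp add: hermitian_mat_def adjoint_mat_def rank_one_def vec_eq_iff mult_ac)

lemma inner_rank_one: "x \<bullet> (rank_one c v *v x) = c * (cmod (cdot v x))\<^sup>2"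
proof -
  have "cdot v x * cdot x v = of_real ((cmod (cdot v x))\<^sup>2)"
    by (metis cnj_cdot complex_norm_square)
  then show ?thesis
    by (simp add: rank_one_mult inner_scale_right mult.assoc)
qed

text \<open>Cauchy-Schwarz for the form of \<open>M\<close>, applied to \<open>x\<close> and its
  projection \<open>w\<close> onto \<open>v\<close>, bounds the form at \<open>x\<close> below by r
  |a|^2 once the common factor r |a|^2 is cancelled. That is exactly the amount which
  \<open>rank_one r v\<close> subtracts.\<close>

lemma psd_deflate:
  assumes psd: "psd_mat M" and "0 < r" and eig: "M *v v = of_real r *s v" and v: "norm v = 1"
  shows "psd_mat (M - rank_one r v)"
proof -
  have "r * (cmod (cdot v x))\<^sup>2 \<le> x \<bullet> (M *v x)" for x
  proof -
    define a where "a = cdot v x"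
    define w where "w = a *s v"
    have Mw: "M *v w = of_real r *s w"
      by (simp add: w_def vector_scalar_commute eig mult.commute)
    have aa: "a * cnj a = of_real ((cmod a)\<^sup>2)"
      by (simp only: complex_norm_square)
    have "cdot x v = cnj a"
      by (simp add: a_def cnj_cdot)
    then have xw: "x \<bullet> w = (cmod a)\<^sup>2"
      by (simp add: w_def inner_scale_right aa)
    have "cdot w v = cnj a"
      by (metis cnj_cdot cdot_scale_right cdot_self mult.right_neutral norm_eq_1 of_real_1 v w_def)
    then have ww: "w \<bullet> w = (cmod a)\<^sup>2"
      by (simp add: w_def inner_scale_right aa)
    have "(x \<bullet> (M *v w))\<^sup>2 \<le> (x \<bullet> (M *v x)) * (w \<bullet> (M *v w))"
      by (rule psd_Cauchy_Schwarz[OF psd])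
    then have "(r * (cmod a)\<^sup>2) * (r * (cmod a)\<^sup>2) \<le> (x \<bullet> (M *v x)) * (r * (cmod a)\<^sup>2)"
      by (simp add: Mw inner_scale_right Re_cdot xw ww power2_eq_square)
    then show ?thesis
      unfolding a_def[symmetric] using \<open>0 < r\<close> psd_nonneg[OF psd, of x]
      by (cases "a = 0") (simp_all add: mult_le_cancel_right)
  qed
  then show ?thesis
    by (simp add: psd_mat_iff hermitian_diff rank_one_hermitian psd_hermitian[OF psd]
        matrix_vector_mult_diff_rdistrib inner_diff_right inner_rank_one)
qed

text \<open>Here \<open>dim\<close> is the real dimension of the range; the induction only needs it
  to drop strictly when an eigenvector is split off.\<close>

lemma psd_sqrt_exists:
  "psd_mat M \<Longrightarrow> \<exists>P. psd_mat P \<and> P ** P = M"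
proof (induction "dim (range ((*v) M))" arbitrary: M rule: less_induct)
  case less
  show ?case
  proof (cases "M = 0")
    case True
    have "psd_mat (0 :: complex ^ 'a ^ 'a)"
      by (simp add: psd_mat_iff hermitian_mat_def adjoint_mat_def vec_eq_iff)
    with True show ?thesis
      by (intro exI[of _ 0]) simp
  next
    case False
    then obtain v r where v: "norm v = 1" and pos: "0 < r"
      and eig: "M *v v = of_real r *s v"
      using psd_eigenvector[OF less.prems] by blast
    let ?N = "M - rank_one r v"
    have vv: "cdot v v = 1"
      using v by (simp add: cdot_self norm_eq_1)
    have N: "?N *v x = M *v x - (of_real r * cdot v x) *s v" for x
      by (simp add: matrix_vector_mult_diff_rdistrib rank_one_mult)
    have psdN: "psd_mat ?N"
      by (rule psd_deflate[OF less.prems pos eig v])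
    have Nv: "?N *v v = 0"
      by (simp add: N eig vv)
    have "range ((*v) ?N) \<subseteq> range ((*v) M)"
    proof (rule image_subsetI)
      fix x
      have "?N *v x = M *v (x - cdot v x *s v)"
        by (simp add: N matrix_vector_mult_diff_distrib vector_scalar_commute eig mult.commute)
      then show "?N *v x \<in> range ((*v) M)" by blast
    qed
    \<comment> \<open>\<open>?N\<close> is Hermitian and kills \<open>v\<close>, so its range is
      orthogonal to \<open>v\<close>.\<close>
    moreover have "v \<notin> range ((*v) ?N)"
    proof
      assume "v \<in> range ((*v) ?N)"
      then obtain x where x: "v = ?N *v x" by blast
      have "v \<bullet> v = v \<bullet> (?N *v x)"
        using x by simp
      also have "\<dots> = 0"
        by (simp add: hermitian_inner[OF psd_hermitian[OF psdN]] Nv)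
      finally show False
        using v by (simp add: norm_eq_1)
    qed
    moreover have "v \<in> range ((*v) M)"
    proof (rule range_eqI)
      show "v = M *v (of_real (1 / r) *s v)"
        using pos by (simp add: vector_scalar_commute eig)
    qed
    ultimately have "range ((*v) ?N) \<subset> range ((*v) M)"
      by blast
    moreover have "subspace (range ((*v) K))" for K :: "complex ^ 'a ^ 'a"
      by (intro linear_subspace_image) simp_all
    ultimately have "dim (range ((*v) ?N)) < dim (range ((*v) M))"
      by (intro dim_psubset) (metis span_eq_iff)
    then obtain P where P: "psd_mat P" "P ** P = ?N"
      using less.hyps psdN by blast
    have PP: "P *v (P *v x) = ?N *v x" for x
      by (simp add: matrix_vector_mul_assoc P(2))
    have "(P *v v) \<bullet> (P *v v) = v \<bullet> (P *v (P *v v))"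
      by (simp add: hermitian_inner[OF psd_hermitian[OF P(1)]])
    also have "\<dots> = 0"
      by (simp only: PP Nv) simp
    finally have Pv: "P *v v = 0" by simp
    have vP: "cdot v (P *v x) = 0" for x
      using psd_hermitian[OF P(1)] by (simp add: cdot_adjoint hermitian_mat_def Pv)
    \<comment> \<open>The root of the deflated matrix kills \<open>v\<close> and has range
      orthogonal to \<open>v\<close>, so squaring \<open>Q\<close> produces no cross terms and
      restores the removed part \<open>rank_one r v\<close>.\<close>
    define Q where "Q = P + rank_one (sqrt r) v"
    have Q: "Q *v x = P *v x + (of_real (sqrt r) * cdot v x) *s v" for x
      by (simp add: Q_def matrix_vector_mult_add_rdistrib rank_one_mult)
    have "Q *v (Q *v x) = M *v x" for x
    proof -
      have s: "complex_of_real (sqrt r) * of_real (sqrt r) = of_real r"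
        using pos by (metis of_real_mult real_sqrt_mult_self abs_of_pos)
      have "Q *v (Q *v x) = P *v (P *v x) + (of_real r * cdot v x) *s v"
        unfolding Q by (simp add: cdot_add_right cdot_scale_right vP vv vector_scalar_commute
            matrix_vector_right_distrib Pv s mult.assoc[symmetric])
      then show ?thesis
        by (simp add: PP N)
    qed
    then have "Q ** Q = M"
      by (simp add: matrix_eq matrix_vector_mul_assoc[symmetric])
    moreover have "psd_mat Q"
      using psd_nonneg[OF P(1)] pos
      by (simp add: psd_mat_iff Q_def hermitian_add psd_hermitian[OF P(1)] rank_one_hermitian
          matrix_vector_mult_add_rdistrib inner_add_right inner_rank_one)
    ultimately show ?thesis by blast
  qed
qed

lemma psd_sqrt_unique:
  assumes P: "psd_mat P" and Q: "psd_mat Q" and eq: "P ** P = Q ** Q"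
  shows "P = Q"
proof (rule ccontr)
  assume "P \<noteq> Q"
  define D where "D = P - Q"
  have D: "D *v x = P *v x - Q *v x" for x
    by (simp add: D_def matrix_vector_mult_diff_rdistrib)
  have hD: "hermitian_mat D"
    unfolding D_def by (intro hermitian_diff psd_hermitian P Q)
  have sq: "P *v (P *v x) = Q *v (Q *v x)" for x
    by (simp add: matrix_vector_mul_assoc eq)
  have DD: "(D ** D) *v x = D *v (D *v x)" for x
    by (simp add: matrix_vector_mul_assoc)
  \<comment> \<open>\<open>D\<close> itself may be indefinite; its square is positive semidefinite,
    so \<open>psd_eigenvector\<close> applies to it.\<close>
  have psdDD: "psd_mat (D ** D)"
    by (simp add: psd_mat_iff hermitian_mult_self[OF hD] DD hermitian_inner[OF hD, of _ "D *v _"])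
  have "D ** D \<noteq> 0"
  proof
    assume "D ** D = 0"
    then have "x \<bullet> (D *v (D *v x)) = 0" for x
      by (simp flip: DD)
    then have "(D *v x) \<bullet> (D *v x) = 0" for x
      by (metis hermitian_inner[OF hD])
    then have "D *v x = 0" for x
      by simp
    then have "D = 0"
      by (simp add: matrix_eq)
    then show False
      using \<open>P \<noteq> Q\<close> by (simp add: D_def)
  qed
  then obtain v r where v: "norm v = 1" and pos: "0 < r"
    and eig: "D *v (D *v v) = of_real r *s v"
    using psd_eigenvector[OF psdDD] DD by metis
  \<comment> \<open>PD = P^2 - PQ = Q^2 - PQ = -DQ, and symmetrically for QD.\<close>
  have PD: "P *v (D *v x) = - (D *v (Q *v x))" and QD: "Q *v (D *v x) = - (D *v (P *v x))" for x
    by (simp_all add: D matrix_vector_mult_diff_distrib sq)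
  have "r * (v \<bullet> (P *v v)) = v \<bullet> (P *v (D *v (D *v v)))"
    by (simp add: eig vector_scalar_commute inner_scale_right Re_cdot)
  \<comment> \<open>Moving one factor \<open>D\<close> to the left exposes minus the form of
    \<open>Q\<close> at \<open>D *v v\<close>, which forces the nonnegative form of \<open>P\<close>
    at \<open>v\<close> to vanish.\<close>
  also have "\<dots> = - ((D *v v) \<bullet> (Q *v (D *v v)))"
    by (simp add: PD hermitian_inner[OF hD])
  finally have "v \<bullet> (P *v v) \<le> 0"
    using psd_nonneg[OF Q, of "D *v v"] pos by (smt (verit) mult_pos_pos)
  then have "P *v v = 0"
    using psd_nonneg[OF P, of v] by (intro psd_form_eq_0_imp[OF P]) simp
  moreover have "r * (v \<bullet> (Q *v v)) = v \<bullet> (Q *v (D *v (D *v v)))"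
    by (simp add: eig vector_scalar_commute inner_scale_right Re_cdot)
  then have "r * (v \<bullet> (Q *v v)) = - ((D *v v) \<bullet> (P *v (D *v v)))"
    by (simp add: QD hermitian_inner[OF hD])
  then have "v \<bullet> (Q *v v) \<le> 0"
    using psd_nonneg[OF P, of "D *v v"] pos by (smt (verit) mult_pos_pos)
  then have "Q *v v = 0"
    using psd_nonneg[OF Q, of v] by (intro psd_form_eq_0_imp[OF Q]) simp
  ultimately have "D *v v = 0"
    by (simp add: D)
  then have "of_real r *s v = 0"
    using eig by simp
  then show False
    using pos v by auto
qed

lemma psd_sqrt_psd:
  assumes "psd_mat M"
  shows "psd_mat (psd_sqrt M)"
proof -
  have "\<exists>!P. psd_mat P \<and> P ** P = M"
    using psd_sqrt_exists[OF assms] psd_sqrt_unique by metis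
  from theI'[OF this] show ?thesis
    by (simp add: psd_sqrt_def)
qed

lemma psd_adjoint_mult_self: "psd_mat (X\<^sup>\<dagger> ** X)"
  by (simp add: psd_mat_iff hermitian_mat_def adjoint_mult matrix_vector_mul_assoc[symmetric]
      inner_adjoint[of _ "X\<^sup>\<dagger>"])

lemma abs_mat_hermitian: "hermitian_mat (abs_mat X)"
  unfolding abs_mat_def by (intro psd_hermitian psd_sqrt_psd psd_adjoint_mult_self)

section \<open>Norm bounds and block matrices\<close>

lemma norm_mult_le_op_norm: "norm (M *v x) \<le> op_norm M * norm x"
  unfolding op_norm_def by (intro onorm) simp

lemma inner_mult_le_op_norm: "x \<bullet> (M *v x) \<le> op_norm M * (x \<bullet> x)"
proof -
  have "x \<bullet> (M *v x) \<le> norm x * norm (M *v x)"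
    by (rule norm_cauchy_schwarz)
  also have "\<dots> \<le> norm x * (op_norm M * norm x)"
    by (intro mult_left_mono norm_mult_le_op_norm) simp
  also have "\<dots> = op_norm M * (x \<bullet> x)"
    by (simp add: dot_square_norm power2_eq_square)
  finally show ?thesis .
qed

text \<open>With y = Mx, Cauchy-Schwarz for the form of \<open>M\<close> gives |y|^4 \<le> (y .
  My)(x . y) \<le> c^2 |y|^2 |x|^2; then |y|^2 cancels.\<close>

lemma psd_op_norm_le:
  assumes psd: "psd_mat M" and "0 \<le> c" and bound: "\<And>x. x \<bullet> (M *v x) \<le> c * (x \<bullet> x)"
  shows "op_norm M \<le> c"
  unfolding op_norm_def
proof (rule onorm_le)
  fix x
  let ?y = "M *v x"
  have "(?y \<bullet> ?y)\<^sup>2 \<le> (?y \<bullet> (M *v ?y)) * (x \<bullet> ?y)"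
    by (rule psd_Cauchy_Schwarz[OF psd])
  also have "\<dots> \<le> (c * (?y \<bullet> ?y)) * (c * (x \<bullet> x))"
    using \<open>0 \<le> c\<close> by (intro mult_mono bound psd_nonneg[OF psd]) simp_all
  finally have "(norm ?y)\<^sup>2 * (norm ?y)\<^sup>2 \<le> (norm ?y)\<^sup>2 * (c * norm x)\<^sup>2"
    by (simp add: dot_square_norm power2_eq_square mult_ac)
  then have "(norm ?y)\<^sup>2 \<le> (c * norm x)\<^sup>2" if "?y \<noteq> 0"
    using that mult_le_cancel_left_pos[of "(norm ?y)\<^sup>2"] by (metis zero_less_norm_iff zero_less_power)
  then show "norm ?y \<le> c * norm x"
    using \<open>0 \<le> c\<close> by (cases "?y = 0") (auto intro: power2_le_imp_le)
qed

definition block_vec :: "complex ^ 'n \<Rightarrow> complex ^ 'm \<Rightarrow> complex ^ ('n + 'm)"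
  where "block_vec x y = (\<chi> i. case i of Inl k \<Rightarrow> x $ k | Inr k \<Rightarrow> y $ k)"

lemma block_vec_cases:
  obtains x y where "z = block_vec x y"
proof
  show "z = block_vec (\<chi> k. z $ Inl k) (\<chi> k. z $ Inr k)"
    by (simp add: block_vec_def vec_eq_iff split: sum.split)
qed

lemma sum_UNIV_sum:
  fixes f :: "'a::finite + 'b::finite \<Rightarrow> 'c::comm_monoid_add"
  shows "sum f UNIV = (\<Sum>i\<in>UNIV. f (Inl i)) + (\<Sum>i\<in>UNIV. f (Inr i))"
  by (simp add: UNIV_Plus_UNIV[symmetric] sum.Plus del: UNIV_Plus_UNIV)

lemma inner_block_vec: "block_vec x y \<bullet> block_vec x' y' = x \<bullet> x' + y \<bullet> y'"
  by (simp add: inner_vec_def sum_UNIV_sum block_vec_def)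

lemma block_mat_mult:
  "block_mat A B C D *v block_vec x y = block_vec (A *v x + B *v y) (C *v x + D *v y)"
  by (simp add: vec_eq_iff block_mat_def block_vec_def matrix_vector_mult_def sum_UNIV_sum
      split: sum.split)

text \<open>The two off-diagonal contributions are complex conjugates, hence agree in the real
  product; this gives the factor 2.\<close>

lemma inner_block_mat:
  fixes A B X :: "complex ^ 'n ^ 'n"
  shows "block_vec x y \<bullet> (block_mat A (X\<^sup>\<dagger>) X B *v block_vec x y)
    = x \<bullet> (A *v x) + 2 * (y \<bullet> (X *v x)) + y \<bullet> (B *v y)"
  by (simp add: block_mat_mult inner_block_vec inner_add_right inner_adjoint[of x "X\<^sup>\<dagger>"]
      inner_commute[of "X *v x"])

lemma unitary_inner:
  assumes "unitary_mat U"
  shows "(U *v x) \<bullet> (U *v y) = x \<bullet> y"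
  using assms by (simp add: inner_adjoint matrix_vector_mul_assoc unitary_mat_def)

theorem theorem2p2:
  fixes A B X U :: "complex ^ 'n ^ 'n"
  assumes "psd_mat (block_mat A (X\<^sup>\<dagger>) X B)"
    and "unitary_mat U"
    and "X = U ** abs_mat X"
  shows "op_norm (block_mat A (X\<^sup>\<dagger>) X B) \<le> op_norm (A + U\<^sup>\<dagger> ** B ** U)"
proof (rule psd_op_norm_le[OF assms(1)])
  let ?M = "block_mat A (X\<^sup>\<dagger>) X B" and ?S = "A + U\<^sup>\<dagger> ** B ** U"
  show "0 \<le> op_norm ?S"
    unfolding op_norm_def by (intro onorm_pos_le) simp
  fix z :: "complex ^ ('n + 'n)"
  obtain x y where z: "z = block_vec x y"
    by (rule block_vec_cases)
  \<comment> \<open>In the coordinates (x, w) the blocks of \<open>?M\<close> become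
    \<open>A\<close>, \<open>abs_mat X\<close> (twice) and
    \<open>U\<^sup>\<dagger> ** B ** U\<close>.\<close>
  define w where "w = U\<^sup>\<dagger> *v y"
  have y: "y = U *v w"
    using assms(2) by (simp add: w_def matrix_vector_mul_assoc unitary_mat_def)
  have S: "u \<bullet> (?S *v u) = u \<bullet> (A *v u) + (U *v u) \<bullet> (B *v (U *v u))" for u
    by (simp add: matrix_vector_mult_add_rdistrib matrix_vector_mul_assoc[symmetric]
        inner_add_right inner_adjoint[of u "U\<^sup>\<dagger>"])
  have X: "(U *v u) \<bullet> (X *v t) = u \<bullet> (abs_mat X *v t)" for u t
    by (metis assms(2,3) matrix_vector_mul_assoc unitary_inner)
  \<comment> \<open>Both sides are the off-diagonal form of \<open>abs_mat X\<close> at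
    \<open>x\<close> and \<open>w\<close>; its being Hermitian allows the two arguments to be
    swapped.\<close>
  have cross: "(U *v x) \<bullet> (X *v w) = y \<bullet> (X *v x)"
    unfolding y X by (simp add: hermitian_inner[OF abs_mat_hermitian, of x] inner_commute)
  have neg: "M *v (- u) = - (M *v u)" for M :: "complex ^ 'n ^ 'n" and u
    by (simp add: linear_neg)
  \<comment> \<open>In the coordinates (x, w) this is the rotated vector (w, -x). Its form is
    nonnegative, so adding it can only increase the bound, while the sign makes the cross terms
    cancel by \<open>cross\<close>.\<close>
  let ?z' = "block_vec w (- (U *v x))"
  have "z \<bullet> (?M *v z) \<le> z \<bullet> (?M *v z) + ?z' \<bullet> (?M *v ?z')"
    using psd_nonneg[OF assms(1)] by simp
  also have "\<dots> = x \<bullet> (?S *v x) + w \<bullet> (?S *v w)"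
    unfolding z inner_block_mat neg S by (simp add: cross flip: y)
  also have "\<dots> \<le> op_norm ?S * (x \<bullet> x) + op_norm ?S * (w \<bullet> w)"
    by (intro add_mono inner_mult_le_op_norm)
  \<comment> \<open>\<open>U\<close> preserves length, so \<open>w\<close> and \<open>y\<close> have
    the same norm.\<close>
  also have "\<dots> = op_norm ?S * (z \<bullet> z)"
    by (simp add: z y inner_block_vec unitary_inner[OF assms(2)] distrib_left)
  finally show "z \<bullet> (?M *v z) \<le> op_norm ?S * (z \<bullet> z)" .
qed

end
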